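(* Let $\mathcal{L}=\langle S, Act_\tau,\to\rangle$ be a finite-branching labelled transition system of processes, and let $\mathcal{T}=\langle T,Act_\tau\cup\{\omega\},\to\rangle$ be a labelled transition system of tests. Then every finitary test $t\in T$ is must-representable: there exists a (closed) formula $\phi\in\mathrm{recHML}$ such that for every $p\in S$, $p\ \mathbf{must\ satisfy}\ t$ if and only if $p\in[\![\phi]\!]$.
   Context: **Labelled transition systems.** An LTS over a set $Act$ of external actions is a triple $\langle S,Act_\tau,\to\rangle$ with $S$ a countable set of states (processes), $Act_\tau=Act\cup\{\tau\}$ a countable set of actions, where $\tau\notin Act$, and $\to\subseteq S\times Act_\tau\times S$; write $s\xrightarrow{\alpha}s'$ for $(s,\alpha,s')\in\to$, and $s\xrightarrow{\alpha}$ if such an $s'$ exists. The letter $a$ ranges over $Act$, $\alpha$ over $Act_\tau$. $\mathrm{Succ}(s)=\{s' : s\xrightarrow{\alpha}s'\text{ for some }\alpha\in Act_\tau\}$; an LTS is finite branching if $\mathrm{Succ}(s)$ is finite for every state $s$. $s\Uparrow$ (diverges) if there is an infinite path $s\xrightarrow{\tau}s_1\xrightarrow{\tau}\cdots$; otherwise $s\Downarrow$ (converges). Weak transitions: $\stackrel{\tau}{\Rightarrow}$ is the reflexive transitive closure of $\xrightarrow{\tau}$, and $s\stackrel{a}{\Rightarrow}s'$ means $s\stackrel{\tau}{\Rightarrow}s''\xrightarrow{a}s'''\stackrel{\tau}{\Rightarrow}s'$ for some $s'',s'''$; $s\stackrel{\alpha}{\Rightarrow}$ means $s\stackrel{\alpha}{\Rightarrow}s'$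 for some $s'$. **The language recHML.** It is the set of closed formulae generated by $\phi ::= \mathtt{tt}\mid\mathtt{ff}\mid X\mid \mathrm{Acc}\,A\mid\phi_1\vee\phi_2\mid\phi_1\wedge\phi_2\mid\langle\alpha\rangle\phi\mid[\alpha]\phi\mid\min(X,\phi)\mid\max(X,\phi)$, where $X$ ranges over a countable set $Var$ of variables, $\alpha\in Act_\tau$, $A$ is a finite subset of $Act$, and $\min(X,\cdot)$, $\max(X,\cdot)$ bind $X$. Given an environment $\rho:Var\to 2^S$: $[\![\mathtt{tt}]\!]\rho=S$; $[\![\mathtt{ff}]\!]\rho=\emptyset$; $[\![X]\!]\rho=\rho(X)$; $[\![\mathrm{Acc}\,A]\!]\rho=\{s : s\Downarrow,\text{ and } s\stackrel{\tau}{\Rightarrow}s'\text{ implies } s'\stackrel{a}{\Rightarrow}\text{ for some }a\in A\}$; $[\![\langle\alpha\rangle\phi]\!]\rho=\{s : s\stackrel{\alpha}{\Rightarrow}s'\text{ for some }s'\in[\![\phi]\!]\rho\}$; $[\![[\alpha]\phi]\!]\rho=\{s : s\Downarrow,\text{ and } s\stackrel{\alpha}{\Rightarrow}s'\text{ implies }s'\in[\![\phi]\!]\rho\}$; $\vee,\wedge$ are interpreted as union and intersection; $[\![\min(X,\phi)]\!]\rho=\bigcap\{P\subseteq S : [\![\phi]\!]\rho[X\mapsto P]\subseteq P\}$; $[\![\max(X,\phi)]\!]\rho=\bigcup\{P\subseteq S : P\subseteq[\![\phi]\!]\rho[X\mapsto P]\}$, where $\rho[X\mapsto P]$ is the environment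 that maps $X$ to $P$ and agrees with $\rho$ elsewhere. For closed $\phi$ the environment is omitted. **Tests.** A test is a state of an LTS $\mathcal{T}=\langle T,Act_\tau\cup\{\omega\},\to\rangle$, where $\omega\notin Act_\tau$ is a special success action. A test $t\in T$ is finitary if the derived LTS consisting of all states in $\mathcal{T}$ accessible from $t$ is finite. **Testing.** For a process $p$ and test $t$, the experiment $p\,|\,t$ has only $\tau$-moves: $p|t\to p'|t$ if $p\xrightarrow{\tau}p'$; $p|t\to p|t'$ if $t\xrightarrow{\tau}t'$; $p|t\to p'|t'$ if $p\xrightarrow{a}p'$ and $t\xrightarrow{a}t'$ for some $a\in Act$. A computation of $p|t$ is a maximal (finite or infinite) path $p|t\to p_1|t_1\to\cdots$ (with $p_0=p$, $t_0=t$); it is successful if $t_n\xrightarrow{\omega}$ for some $n\ge0$. $p\ \mathbf{must\ satisfy}\ t$ if every computation of $p|t$ is successful. *)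

theory Defs
  imports Main "HOL-Library.Countable_Set" "HOL-Library.Extended_Nat" "HOL-Library.FSet"
begin

section \<open>Labelled transition systems\<close>

datatype 'a action = Tau | Ext 'a

datatype 'a test_action = Lab "'a action" | Success

definition Act_tau :: "'a set \<Rightarrow> 'a action set" where
  "Act_tau Act = insert Tau (Ext ` Act)"

definition Act_test :: "'a set \<Rightarrow> 'a test_action set" where
  "Act_test Act = insert Success (Lab ` Act_tau Act)"

type_synonym ('s, 'l) trans = "('s \<times> 'l \<times> 's) set"

definition lts :: "'s set \<Rightarrow> 'l set \<Rightarrow> ('s, 'l) trans \<Rightarrow> bool" where
  "lts S L R \<longleftrightarrow> countable S \<and> countable L \<and> R \<subseteq> S \<times> L \<times> S"

definition Succ :: "('s, 'l) trans \<Rightarrow> 's \<Rightarrow> 's set" where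
  "Succ R s = {s'. \<exists>\<alpha>. (s, \<alpha>, s') \<in> R}"

definition finite_branching :: "'s set \<Rightarrow> ('s, 'l) trans \<Rightarrow> bool" where
  "finite_branching S R \<longleftrightarrow> (\<forall>s\<in>S. finite (Succ R s))"

definition tau_steps :: "('s, 'a action) trans \<Rightarrow> 's rel" where
  "tau_steps R = {(s, s'). (s, Tau, s') \<in> R}"

definition diverges :: "('s, 'a action) trans \<Rightarrow> 's \<Rightarrow> bool" where
  "diverges R s \<longleftrightarrow> (\<exists>f :: nat \<Rightarrow> 's. f 0 = s \<and> (\<forall>i. (f i, f (Suc i)) \<in> tau_steps R))"

abbreviation converges :: "('s, 'a action) trans \<Rightarrow> 's \<Rightarrow> bool" where
  "converges R s \<equiv> \<not> diverges R s"

fun weak :: "('s, 'a action) trans \<Rightarrow> 'a action \<Rightarrow> 's rel" where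
  "weak R Tau = (tau_steps R)\<^sup>*"
| "weak R (Ext a) = (tau_steps R)\<^sup>* O {(s, s'). (s, Ext a, s') \<in> R} O (tau_steps R)\<^sup>*"


section \<open>The language recHML\<close>

(* Variables are natural numbers.  The selector acts collects the external
   actions occurring in a formula, including those in the sets of Acc. *)
datatype (acts: 'a) form =
    TT
  | FF
  | Var nat
  | Acc "'a fset"
  | Or "'a form" "'a form"
  | And "'a form" "'a form"
  | Dia "'a action" "'a form"
  | Box "'a action" "'a form"
  | FMin nat "'a form"
  | FMax nat "'a form"

primrec fv :: "'a form \<Rightarrow> nat set" where
  "fv TT = {}"
| "fv FF = {}"
| "fv (Var X) = {X}"
| "fv (Acc A) = {}"
| "fv (Or \<phi> \<psi>) = fv \<phi> \<union> fv \<psi>"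
| "fv (And \<phi> \<psi>) = fv \<phi> \<union> fv \<psi>"
| "fv (Dia \<alpha> \<phi>) = fv \<phi>"
| "fv (Box \<alpha> \<phi>) = fv \<phi>"
| "fv (FMin X \<phi>) = fv \<phi> - {X}"
| "fv (FMax X \<phi>) = fv \<phi> - {X}"

definition recHML :: "'a set \<Rightarrow> 'a form set" where
  "recHML Act = {\<phi>. acts \<phi> \<subseteq> Act \<and> fv \<phi> = {}}"

primrec sem :: "'s set \<Rightarrow> ('s, 'a action) trans \<Rightarrow> 'a form \<Rightarrow> (nat \<Rightarrow> 's set) \<Rightarrow> 's set" where
  "sem S R TT \<rho> = S"
| "sem S R FF \<rho> = {}"
| "sem S R (Var X) \<rho> = \<rho> X"
| "sem S R (Acc A) \<rho> =
     {s \<in> S. converges R s \<and>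
        (\<forall>s'. (s, s') \<in> weak R Tau \<longrightarrow> (\<exists>a s''. a |\<in>| A \<and> (s', s'') \<in> weak R (Ext a)))}"
| "sem S R (Or \<phi> \<psi>) \<rho> = sem S R \<phi> \<rho> \<union> sem S R \<psi> \<rho>"
| "sem S R (And \<phi> \<psi>) \<rho> = sem S R \<phi> \<rho> \<inter> sem S R \<psi> \<rho>"
| "sem S R (Dia \<alpha> \<phi>) \<rho> = {s \<in> S. \<exists>s'. (s, s') \<in> weak R \<alpha> \<and> s' \<in> sem S R \<phi> \<rho>}"
| "sem S R (Box \<alpha> \<phi>) \<rho> =
     {s \<in> S. converges R s \<and> (\<forall>s'. (s, s') \<in> weak R \<alpha> \<longrightarrow> s' \<in> sem S R \<phi> \<rho>)}"
| "sem S R (FMin X \<phi>) \<rho> = \<Inter> {P. P \<subseteq> S \<and> sem S R \<phi> (\<rho>(X := P)) \<subseteq> P}"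
| "sem S R (FMax X \<phi>) \<rho> = \<Union> {P. P \<subseteq> S \<and> P \<subseteq> sem S R \<phi> (\<rho>(X := P))}"

lemma sem_cong_fv:
  "(\<And>X. X \<in> fv \<phi> \<Longrightarrow> \<rho> X = \<rho>' X) \<Longrightarrow> sem S R \<phi> \<rho> = sem S R \<phi> \<rho>'"
proof (induction \<phi> arbitrary: \<rho> \<rho>')
  case (Or \<phi> \<psi>)
  have "sem S R \<phi> \<rho> = sem S R \<phi> \<rho>'" "sem S R \<psi> \<rho> = sem S R \<psi> \<rho>'"
    using Or.prems by (auto intro!: Or.IH)
  then show ?case by simp
next
  case (And \<phi> \<psi>)
  have "sem S R \<phi> \<rho> = sem S R \<phi> \<rho>'" "sem S R \<psi> \<rho> = sem S R \<psi> \<rho>'"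
    using And.prems by (auto intro!: And.IH)
  then show ?case by simp
next
  case (Dia \<alpha> \<phi>)
  have "sem S R \<phi> \<rho> = sem S R \<phi> \<rho>'"
    using Dia.prems by (auto intro!: Dia.IH)
  then show ?case by simp
next
  case (Box \<alpha> \<phi>)
  have "sem S R \<phi> \<rho> = sem S R \<phi> \<rho>'"
    using Box.prems by (auto intro!: Box.IH)
  then show ?case by simp
next
  case (FMin X \<phi>)
  have "sem S R \<phi> (\<rho>(X := P)) = sem S R \<phi> (\<rho>'(X := P))" for P
    using FMin.prems by (intro FMin.IH) simp
  then show ?case by simp
next
  case (FMax X \<phi>)
  have "sem S R \<phi> (\<rho>(X := P)) = sem S R \<phi> (\<rho>'(X := P))" for P
    using FMax.prems by (intro FMax.IH) simp
  then show ?case by simp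
qed simp_all

(* The environment is immaterial for closed formulae, see sem_closed. *)
definition sem0 :: "'s set \<Rightarrow> ('s, 'a action) trans \<Rightarrow> 'a form \<Rightarrow> 's set" where
  "sem0 S R \<phi> = sem S R \<phi> (\<lambda>_. {})"

lemma sem_closed: "fv \<phi> = {} \<Longrightarrow> sem S R \<phi> \<rho> = sem0 S R \<phi>"
  unfolding sem0_def by (rule sem_cong_fv) simp


section \<open>Tests and must testing\<close>

definition accessible :: "('t, 'l) trans \<Rightarrow> 't \<Rightarrow> 't set" where
  "accessible R t = {u. (t, u) \<in> {(v, w). w \<in> Succ R v}\<^sup>*}"

(* Finiteness of the derived LTS is finiteness of its states and of its transitions.
   The second part does not follow from the first when Act is infinite. *)
definition finitary :: "('t, 'l) trans \<Rightarrow> 't \<Rightarrow> bool" where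
  "finitary R t \<longleftrightarrow>
     finite (accessible R t) \<and> finite {(u, l, v). (u, l, v) \<in> R \<and> u \<in> accessible R t}"

inductive_set exper_step ::
    "('s, 'a action) trans \<Rightarrow> ('t, 'a test_action) trans \<Rightarrow> ('s \<times> 't) rel"
  for R :: "('s, 'a action) trans" and Q :: "('t, 'a test_action) trans" where
  proc: "(p, Tau, p') \<in> R \<Longrightarrow> ((p, t), (p', t)) \<in> exper_step R Q"
| test: "(t, Lab Tau, t') \<in> Q \<Longrightarrow> ((p, t), (p, t')) \<in> exper_step R Q"
| sync: "(p, Ext a, p') \<in> R \<Longrightarrow> (t, Lab (Ext a), t') \<in> Q \<Longrightarrow>
           ((p, t), (p', t')) \<in> exper_step R Q"

(* The states of the computation are c i for i \<le> n; it is infinite if n = \<infinity>,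
   and the values of c beyond n are irrelevant. *)
definition computation ::
    "('s, 'a action) trans \<Rightarrow> ('t, 'a test_action) trans \<Rightarrow> 's \<Rightarrow> 't \<Rightarrow>
     (nat \<Rightarrow> 's \<times> 't) \<Rightarrow> enat \<Rightarrow> bool" where
  "computation R Q p t c n \<longleftrightarrow>
     c 0 = (p, t) \<and>
     (\<forall>i. enat i < n \<longrightarrow> (c i, c (Suc i)) \<in> exper_step R Q) \<and>
     (\<forall>m. n = enat m \<longrightarrow> c m \<notin> Domain (exper_step R Q))"

definition successful :: "('t, 'a test_action) trans \<Rightarrow> (nat \<Rightarrow> 's \<times> 't) \<Rightarrow> enat \<Rightarrow> bool" where
  "successful Q c n \<longleftrightarrow> (\<exists>i. enat i \<le> n \<and> (\<exists>u. (snd (c i), Success, u) \<in> Q))"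

definition must_satisfy ::
    "('s, 'a action) trans \<Rightarrow> ('t, 'a test_action) trans \<Rightarrow> 's \<Rightarrow> 't \<Rightarrow> bool" where
  "must_satisfy R Q p t \<longleftrightarrow> (\<forall>c n. computation R Q p t c n \<longrightarrow> successful Q c n)"

definition must_representable ::
    "'a set \<Rightarrow> 's set \<Rightarrow> ('s, 'a action) trans \<Rightarrow> ('t, 'a test_action) trans \<Rightarrow> 't \<Rightarrow> bool" where
  "must_representable Act S R Q t \<longleftrightarrow>
     (\<exists>\<phi>\<in>recHML Act. \<forall>p\<in>S. must_satisfy R Q p t \<longleftrightarrow> p \<in> sem0 S R \<phi>)"

end

(* The pairs (process, test) for which must testing succeeds form the least fixed point of the
   one-step condition "the test reports success, or some step exists and every step leads to
   such a pair".  Grouping the steps of the process into weak transitions turns this into a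
   system of equations, one per test state: a test that does not report success requires the
   process to converge and to satisfy [alpha] X_u for each of its transitions labelled alpha to u,
   and, if it is stable, also to satisfy Acc A for the set A of its initial actions.  For a
   finitary test the system is finite, and eliminating its variables one at a time (Bekic)
   expresses each component of the simultaneous least solution by nested minimal fixed points. *)
theory Submission
  imports Defs
begin

section \<open>Must testing as a least fixed point\<close>

text \<open>Being inductive, the predicate admits no infinite run that avoids success. The
  \<open>Domain\<close> premise rules out the other way to fail, a deadlock, for which the second
  premise of \<open>step\<close> alone would hold vacuously.\<close>

inductive passes :: "('s, 'a action) trans \<Rightarrow> ('t, 'a test_action) trans \<Rightarrow> 's \<times> 't \<Rightarrow> bool"
  for R :: "('s, 'a action) trans" and Q :: "('t, 'a test_action) trans" where
  success: "(t, Success, u) \<in> Q \<Longrightarrow> passes R Q (p, t)"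
| step: "x \<in> Domain (exper_step R Q) \<Longrightarrow> (\<And>y. (x, y) \<in> exper_step R Q \<Longrightarrow> passes R Q y)
    \<Longrightarrow> passes R Q x"

text \<open>The claim is stated for an arbitrary position \<open>i\<close> of the computation so
  that the induction hypothesis applies to the tail starting at \<open>Suc i\<close>.\<close>

lemma passes_imp_successful:
  assumes "passes R Q x" and comp: "computation R Q p t c n" and "c i = x" and "enat i \<le> n"
  shows "successful Q c n"
  using assms(1,3,4)
proof (induction arbitrary: i)
  case (success t u p)
  then show ?case
    unfolding successful_def by (metis snd_conv)
next
  case (step x)
  show ?case
  proof (cases "n = enat i")
    \<comment> \<open>A computation ending at \<open>x\<close> has no further step by maximality,
      against the \<open>Domain\<close> premise.\<close>
    case True
    then show ?thesis
      using comp step unfolding computation_def by auto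
  next
    case False
    then have "enat i < n"
      using step.prems by simp
    then have "(x, c (Suc i)) \<in> exper_step R Q" and "enat (Suc i) \<le> n"
      using comp step.prems by (auto simp: computation_def Suc_ile_eq)
    then show ?thesis
      using step.IH by blast
  qed
qed

text \<open>A failing pair is deadlocked or has a failing successor, by contraposition of
  \<open>passes.step\<close>. Iterated choice gives a path through failing pairs only, and none of
  these reports success.\<close>

lemma not_passes_imp_failing_computation:
  assumes "\<not> passes R Q (p, t)"
  obtains c n where "computation R Q p t c n" and "\<not> successful Q c n"
proof -
  let ?E = "exper_step R Q"
  \<comment> \<open>The path stutters at a deadlocked pair; this keeps \<open>c\<close> total and
    only affects indices beyond the length \<open>n\<close> chosen below.\<close>
  define next_state where
    "next_state x = (if x \<in> Domain ?E then SOME y. (x, y) \<in> ?E \<and> \<not> passes R Q y else x)" for x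
  define c where "c i = (next_state ^^ i) (p, t)" for i
  have next_state: "(x \<in> Domain ?E \<longrightarrow> (x, next_state x) \<in> ?E) \<and> \<not> passes R Q (next_state x)"
    if "\<not> passes R Q x" for x
  proof (cases "x \<in> Domain ?E")
    case True
    then have "\<exists>y. (x, y) \<in> ?E \<and> \<not> passes R Q y"
      using that passes.step by blast
    from someI_ex[OF this] show ?thesis
      using True by (simp add: next_state_def)
  next
    case False
    then show ?thesis
      using that by (simp add: next_state_def)
  qed
  have c_Suc: "c (Suc i) = next_state (c i)" for i
    by (simp add: c_def)
  have fails: "\<not> passes R Q (c i)" for i
    by (induction i) (use assms next_state in \<open>auto simp: c_Suc, simp add: c_def\<close>)
  have step: "(c i, c (Suc i)) \<in> ?E" if "c i \<in> Domain ?E" for i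
    using next_state[OF fails] that by (simp add: c_Suc)
  \<comment> \<open>The path is cut at its first deadlock: every earlier pair has a step, and the
    last one has none.\<close>
  define n where
    "n = (if \<exists>m. c m \<notin> Domain ?E then enat (LEAST m. c m \<notin> Domain ?E) else \<infinity>)"
  have "c i \<in> Domain ?E" if "enat i < n" for i
    using that not_less_Least[of i "\<lambda>m. c m \<notin> Domain ?E"] by (auto simp: n_def split: if_splits)
  moreover have "c m \<notin> Domain ?E" if "n = enat m" for m
    using that LeastI_ex[of "\<lambda>m. c m \<notin> Domain ?E"] by (auto simp: n_def split: if_splits)
  ultimately have "computation R Q p t c n"
    using step by (simp add: computation_def c_def)
  moreover have "\<not> successful Q c n"
    using fails passes.success unfolding successful_def by (metis prod.collapse)
  ultimately show thesis
    by (rule that)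
qed

lemma must_satisfy_iff_passes: "must_satisfy R Q p t \<longleftrightarrow> passes R Q (p, t)"
proof
  assume "must_satisfy R Q p t"
  then show "passes R Q (p, t)"
    by (meson must_satisfy_def not_passes_imp_failing_computation)
next
  assume "passes R Q (p, t)"
  then show "must_satisfy R Q p t"
    unfolding must_satisfy_def
    by (metis computation_def i0_lb passes_imp_successful zero_enat_def)
qed


section \<open>Convergence and weak transitions\<close>

lemma converges_tau: "converges R p \<Longrightarrow> (p, p') \<in> tau_steps R \<Longrightarrow> converges R p'"
proof
  assume "converges R p" and step: "(p, p') \<in> tau_steps R" and "diverges R p'"
  then obtain f where f: "f 0 = p'" "\<And>i. (f i, f (Suc i)) \<in> tau_steps R"
    by (auto simp: diverges_def)
  have "diverges R p"
    unfolding diverges_def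
    by (rule exI[of _ "case_nat p f"]) (use step f in \<open>auto split: nat.split\<close>)
  with \<open>converges R p\<close> show False
    by simp
qed

lemma converges_if_successors_converge:
  assumes "\<And>p'. (p, p') \<in> tau_steps R \<Longrightarrow> converges R p'"
  shows "converges R p"
proof
  assume "diverges R p"
  then obtain f where f: "f 0 = p" "\<And>i. (f i, f (Suc i)) \<in> tau_steps R"
    by (auto simp: diverges_def)
  then have "diverges R (f (Suc 0))"
    unfolding diverges_def by (intro exI[of _ "\<lambda>i. f (Suc i)"]) auto
  then show False
    using assms f by metis
qed

text \<open>Convergence is well-foundedness of the tau-steps below \<open>p\<close>: a converging
  counterexample would have a counterexample among its tau-successors, which converge too, and
  dependent choice would build a divergence.\<close>

lemma converges_induct [consumes 1, case_names step]:
  assumes "converges R p"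
    and step: "\<And>p. converges R p \<Longrightarrow> (\<And>p'. (p, p') \<in> tau_steps R \<Longrightarrow> P p') \<Longrightarrow> P p"
  shows "P p"
proof (rule ccontr)
  assume "\<not> P p"
  have "\<exists>p'. (converges R p' \<and> \<not> P p') \<and> (q, p') \<in> tau_steps R"
    if "converges R q \<and> \<not> P q" for q
    using that step converges_tau by metis
  \<comment> \<open>The conjunct for \<open>i = 0\<close> makes the chosen chain start at
    \<open>p\<close>.\<close>
  then have "\<exists>f. \<forall>i. ((converges R (f i) \<and> \<not> P (f i)) \<and> (i = 0 \<longrightarrow> f i = p))
      \<and> (f i, f (Suc i)) \<in> tau_steps R"
    using dependent_nat_choice[of "\<lambda>i q. (converges R q \<and> \<not> P q) \<and> (i = 0 \<longrightarrow> q = p)"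
        "\<lambda>_ q p'. (q, p') \<in> tau_steps R"] assms(1) \<open>\<not> P p\<close> by auto
  then have "diverges R p"
    unfolding diverges_def by blast
  with assms(1) show False
    by simp
qed

lemma weak_tau_left: "(p, p') \<in> tau_steps R \<Longrightarrow> (p', q) \<in> weak R \<alpha> \<Longrightarrow> (p, q) \<in> weak R \<alpha>"
  by (cases \<alpha>) (auto intro: converse_rtrancl_into_rtrancl)

lemma strong_imp_weak: "(p, \<alpha>, q) \<in> R \<Longrightarrow> (p, q) \<in> weak R \<alpha>"
  by (cases \<alpha>) (auto simp: tau_steps_def)

text \<open>Splits off the first strong step, since inductions over experiments see only strong
  steps. After a tau-step the rest is a weak transition with the same label.\<close>

lemma weak_cases:
  assumes "(p, q) \<in> weak R \<alpha>"
  obtains (refl) "\<alpha> = Tau" and "p = q"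
  | (tau) p' where "(p, p') \<in> tau_steps R" and "(p', q) \<in> weak R \<alpha>"
  | (ext) a p' where "\<alpha> = Ext a" and "(p, Ext a, p') \<in> R" and "(p', q) \<in> (tau_steps R)\<^sup>*"
proof (cases \<alpha>)
  case Tau
  with assms that(1,2) show thesis
    by (auto elim: converse_rtranclE)
next
  case (Ext a)
  then obtain p' q' where "(p, p') \<in> (tau_steps R)\<^sup>*" "(p', Ext a, q') \<in> R" "(q', q) \<in> (tau_steps R)\<^sup>*"
    using assms by auto
  then show thesis
    using that(2,3) Ext by (cases rule: converse_rtranclE) auto
qed


section \<open>The equation system of a test\<close>

definition success_test :: "('t, 'a test_action) trans \<Rightarrow> 't \<Rightarrow> bool" where
  "success_test Q t \<longleftrightarrow> (\<exists>u. (t, Success, u) \<in> Q)"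

definition stable_test :: "('t, 'a test_action) trans \<Rightarrow> 't \<Rightarrow> bool" where
  "stable_test Q t \<longleftrightarrow> (\<nexists>u. (t, Lab Tau, u) \<in> Q)"

definition initials :: "('t, 'a test_action) trans \<Rightarrow> 't \<Rightarrow> 'a set" where
  "initials Q t = {a. \<exists>u. (t, Lab (Ext a), u) \<in> Q}"

text \<open>The conjuncts are those of \<open>Acc\<close> and \<open>Box\<close>, with their common
  convergence requirement stated once. The \<open>Acc\<close> clause concerns deadlock: an unstable
  test can always move by itself, whereas a stable one must still be able to synchronise, wherever
  the process goes by tau-steps.\<close>

definition must_rhs ::
    "'s set \<Rightarrow> ('s, 'a action) trans \<Rightarrow> ('t, 'a test_action) trans \<Rightarrow> ('t \<Rightarrow> 's set) \<Rightarrow> 't \<Rightarrow> 's set"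
  where
  "must_rhs S R Q f t = {p \<in> S. success_test Q t \<or>
     converges R p \<and>
     (stable_test Q t \<longrightarrow>
       (\<forall>p'. (p, p') \<in> weak R Tau \<longrightarrow> (\<exists>a \<in> initials Q t. \<exists>p''. (p', p'') \<in> weak R (Ext a)))) \<and>
     (\<forall>\<alpha> u. (t, Lab \<alpha>, u) \<in> Q \<longrightarrow> (\<forall>p'. (p, p') \<in> weak R \<alpha> \<longrightarrow> p' \<in> f u))}"

lemma must_rhs_mono: "f \<le> g \<Longrightarrow> must_rhs S R Q f t \<subseteq> must_rhs S R Q g t"
  unfolding must_rhs_def le_fun_def by blast

text \<open>All clauses speak of convergence or of all weak derivatives, and the weak derivatives of
  \<open>p'\<close> are among those of \<open>p\<close>; hence nothing is required of
  \<open>f\<close>.\<close>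

lemma must_rhs_tau:
  assumes "R \<subseteq> S \<times> A \<times> S" and "p \<in> must_rhs S R Q f t" and "(p, p') \<in> tau_steps R"
  shows "p' \<in> must_rhs S R Q f t"
proof -
  have "p' \<in> S"
    using assms by (auto simp: tau_steps_def)
  moreover have "(p, q) \<in> weak R \<alpha>" if "(p', q) \<in> weak R \<alpha>" for q \<alpha>
    using weak_tau_left that assms(3) by fast
  ultimately show ?thesis
    using assms(2) converges_tau[OF _ assms(3)] unfolding must_rhs_def by blast
qed

lemma must_rhs_tau_rtrancl:
  assumes "R \<subseteq> S \<times> A \<times> S" and "(p, p') \<in> (tau_steps R)\<^sup>*" and "p \<in> must_rhs S R Q f t"
  shows "p' \<in> must_rhs S R Q f t"
  using assms(2,3) by induction (use must_rhs_tau[OF assms(1)] in auto)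

text \<open>The process may run on while the test waits in \<open>t\<close>, so a divergence would
  give an infinite run without success. The induction keeps \<open>t\<close> fixed and follows
  \<open>proc\<close> steps only.\<close>

lemma passes_imp_converges:
  assumes "passes R Q (p, t)" and "\<not> success_test Q t"
  shows "converges R p"
  using assms
proof (induction "(p, t)" arbitrary: p rule: passes.induct)
  case (success u)
  then show ?case
    by (auto simp: success_test_def)
next
  case step
  have "converges R p'" if "(p, p') \<in> tau_steps R" for p'
  proof (rule step.hyps(3)[OF _ step.prems])
    show "((p, t), (p', t)) \<in> exper_step R Q"
      using that by (auto simp: tau_steps_def intro: exper_step.proc)
  qed
  then show ?case
    by (rule converges_if_successors_converge)
qed

text \<open>This makes the passing pairs a pre-fixed point, and so an upper bound of the least
  solution. Induction on the convergence of \<open>p\<close> handles the steps that keep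
  \<open>t\<close>; every step of the test leads to a pair already known to pass.\<close>

lemma must_rhs_passes_subset:
  assumes R: "R \<subseteq> S \<times> A \<times> S"
    and f: "\<And>u. f u = {p \<in> S. passes R Q (p, u)}"
    and p: "p \<in> must_rhs S R Q f t"
  shows "passes R Q (p, t)"
proof (cases "success_test Q t")
  case True
  then show ?thesis
    by (auto simp: success_test_def intro: passes.success)
next
  case False
  then have "converges R p"
    using p by (simp add: must_rhs_def)
  then show ?thesis
    using p
  proof (induction rule: converges_induct)
    case (step p)
    have box: "passes R Q (p', u)" if "(t, Lab \<alpha>, u) \<in> Q" "(p, p') \<in> weak R \<alpha>" for \<alpha> u p'
      using step.prems False that f by (auto simp: must_rhs_def)
    have "(p, t) \<in> Domain (exper_step R Q)"
    proof (cases "stable_test Q t")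
      case True
      \<comment> \<open>The \<open>Acc\<close> clause is used for the empty sequence of tau-steps.
        The first strong step towards \<open>q\<close> is a tau-step or an \<open>a\<close>-step,
        and the experiment can follow either.\<close>
      then obtain a u q where u: "(t, Lab (Ext a), u) \<in> Q" and q: "(p, q) \<in> weak R (Ext a)"
        using step.prems False unfolding must_rhs_def initials_def
        by (fastforce simp del: weak.simps(2))
      from q show ?thesis
        by (cases rule: weak_cases)
          (use u in \<open>auto simp: tau_steps_def intro: exper_step.proc exper_step.sync\<close>)
    next
      case False
      then show ?thesis
        by (auto simp: stable_test_def intro: exper_step.test)
    qed
    moreover have "passes R Q (q, u)" if "((p, t), (q, u)) \<in> exper_step R Q" for q u
      using that
    proof cases
      case proc
      then show ?thesis
        using step.IH must_rhs_tau[OF R step.prems] by (simp add: tau_steps_def)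
    next
      case test
      then show ?thesis
        using box[of Tau] by simp
    next
      case (sync a)
      then show ?thesis
        using box strong_imp_weak by fast
    qed
    ultimately show ?case
      by (auto intro: passes.step)
  qed
qed

text \<open>Induction on the derivation of passing works for every fixed point \<open>f\<close>: the
  hypothesis places the state after the first strong step in \<open>f\<close>, and unfolding
  \<open>f\<close> there gives the clauses that cover the rest of a weak transition.\<close>

lemma passes_subset_must_rhs_fixpoint:
  assumes R: "R \<subseteq> S \<times> A \<times> S"
    and f: "\<And>u. f u = must_rhs S R Q f u"
    and "passes R Q (p, t)" and "p \<in> S"
  shows "p \<in> f t"
  using assms(3,4)
proof (induction "(p, t)" arbitrary: p t rule: passes.induct)
  case (success t u p)
  then have "p \<in> must_rhs S R Q f t"
    by (auto simp: must_rhs_def success_test_def)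
  then show ?case
    using f by simp
next
  case (step p t)
  have passes: "passes R Q (p, t)"
    using step.hyps by (meson passes.step)
  have step_IH: "p' \<in> f u" if "((p, t), (p', u)) \<in> exper_step R Q" for p' u
  proof -
    have "p' \<in> S"
      using that R step.prems by cases auto
    then show ?thesis
      using step.hyps(3)[OF that] by simp
  qed
  have tau_IH: "p' \<in> must_rhs S R Q f t" if "(p, p') \<in> tau_steps R" for p'
    using step_IH[of p' t] that f by (auto simp: tau_steps_def intro: exper_step.proc)
  have "p \<in> must_rhs S R Q f t"
  proof (cases "success_test Q t")
    case True
    then show ?thesis
      using step.prems by (simp add: must_rhs_def)
  next
    case False
    have "converges R p"
      using passes_imp_converges[OF passes False] .
    moreover have "\<exists>a \<in> initials Q t. \<exists>p''. (p', p'') \<in> weak R (Ext a)"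
      if weak: "(p, p') \<in> weak R Tau" and stable: "stable_test Q t" for p'
      using weak
    proof (cases rule: weak_cases)
      \<comment> \<open>Some step exists by the \<open>Domain\<close> premise. The test being
        stable, it is a synchronisation, which exhibits an initial action, or a tau-step to
        \<open>q\<close>, whose own \<open>Acc\<close> clause carries back to
        \<open>p\<close>.\<close>
      case refl
      obtain q v where "((p, t), (q, v)) \<in> exper_step R Q"
        using step.hyps(1) by auto
      then show ?thesis
      proof cases
        case proc
        then have "q \<in> must_rhs S R Q f t" and q: "(p, q) \<in> tau_steps R"
          using tau_IH by (auto simp: tau_steps_def)
        then obtain a r where "a \<in> initials Q t" "(q, r) \<in> weak R (Ext a)"
          using False stable unfolding must_rhs_def by fastforce
        then show ?thesis
          using weak_tau_left[OF q] refl by blast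
      next
        case test
        then show ?thesis
          using stable by (auto simp: stable_test_def)
      next
        case (sync a)
        then show ?thesis
          using strong_imp_weak[of p "Ext a" q R] refl by (auto simp: initials_def)
      qed
    next
      case (tau p1)
      then show ?thesis
        using tau_IH[of p1] False stable unfolding must_rhs_def by blast
    next
      case (ext a p')
      then show ?thesis
        by simp
    qed
    moreover have "p' \<in> f u" if u: "(t, Lab \<alpha>, u) \<in> Q" and "(p, p') \<in> weak R \<alpha>" for \<alpha> u p'
      using that(2)
    proof (cases rule: weak_cases)
      case refl
      then show ?thesis
        using step_IH u by (auto intro: exper_step.test)
    next
      case (tau p1)
      then show ?thesis
        using tau_IH[of p1] False u unfolding must_rhs_def by blast
    next
      case (ext a p1)
      \<comment> \<open>The synchronisation puts \<open>p1\<close> into the equation for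
        \<open>u\<close>; closure under tau-steps then takes care of the trailing moves to
        \<open>p'\<close>.\<close>
      then have "p1 \<in> must_rhs S R Q f u"
        using step_IH[of p1 u] u f by (auto intro: exper_step.sync)
      then have "p' \<in> must_rhs S R Q f u"
        by (rule must_rhs_tau_rtrancl[OF R ext(3)])
      then show ?thesis
        using f by simp
    qed
    ultimately show ?thesis
      using step.prems by (simp add: must_rhs_def)
  qed
  then show ?case
    using f by simp
qed


section \<open>Eliminating the variables of the system\<close>

text \<open>The least solution of the system in which the unknowns in \<open>V\<close> are frozen as
  parameters with values \<open>\<eta>\<close>; for empty \<open>V\<close> it is the least solution
  of the whole system.\<close>

definition partial_lfp :: "(('t \<Rightarrow> 's set) \<Rightarrow> 't \<Rightarrow> 's set) \<Rightarrow> 't set \<Rightarrow> ('t \<Rightarrow> 's set) \<Rightarrow> 't \<Rightarrow> 's set"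
  where "partial_lfp F V \<eta> = lfp (\<lambda>f u. if u \<in> V then \<eta> u else F f u)"

lemma partial_lfp_unfold:
  assumes "mono F"
  shows "partial_lfp F V \<eta> u = (if u \<in> V then \<eta> u else F (partial_lfp F V \<eta>) u)"
proof -
  have "mono (\<lambda>f u. if u \<in> V then \<eta> u else F f u)"
    using assms by (auto simp: mono_def le_fun_def)
  from lfp_unfold[OF this] show ?thesis
    unfolding partial_lfp_def by (rule fun_cong)
qed

lemma partial_lfp_lowerbound:
  "(\<And>u. (if u \<in> V then \<eta> u else F f u) \<subseteq> f u) \<Longrightarrow> partial_lfp F V \<eta> \<le> f"
  unfolding partial_lfp_def by (rule lfp_lowerbound) (simp add: le_fun_def)

lemma partial_lfp_cong:
  "(\<And>u. u \<in> V \<Longrightarrow> \<eta> u = \<eta>' u) \<Longrightarrow> partial_lfp F V \<eta> = partial_lfp F V \<eta>'"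
  unfolding partial_lfp_def by (intro arg_cong[of _ _ lfp] ext) simp

text \<open>Freezing \<open>t\<close> at an admissible \<open>P\<close> gives a pre-fixed point of
  the system with \<open>t\<close> free, whence the first inclusion. For the second, the component
  at \<open>t\<close> of the solution is itself an admissible \<open>P\<close>. The bound
  \<open>S\<close> is needed to match \<open>FMin\<close>, which ranges over subsets of
  \<open>S\<close> only.\<close>

lemma partial_lfp_bekic:
  assumes F: "mono F" and "t \<notin> V" and S: "\<And>f. F f t \<subseteq> S"
  shows "partial_lfp F V \<eta> t =
    \<Inter> {P. P \<subseteq> S \<and> F (partial_lfp F (insert t V) (\<eta>(t := P))) t \<subseteq> P}"
proof
  show "partial_lfp F V \<eta> t \<subseteq> \<Inter> {P. P \<subseteq> S \<and> F (partial_lfp F (insert t V) (\<eta>(t := P))) t \<subseteq> P}"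
  proof (rule Inter_greatest, clarify del: subsetI)
    fix P
    let ?g = "partial_lfp F (insert t V) (\<eta>(t := P))"
    assume "F ?g t \<subseteq> P"
    then have "partial_lfp F V \<eta> \<le> ?g"
      using \<open>t \<notin> V\<close>
      by (intro partial_lfp_lowerbound) (auto simp: partial_lfp_unfold[OF F, of "insert t V"])
    moreover have "?g t = P"
      by (simp add: partial_lfp_unfold[OF F])
    ultimately show "partial_lfp F V \<eta> t \<subseteq> P"
      by (metis le_funD)
  qed
next
  let ?f = "partial_lfp F V \<eta>"
  have f: "?f t = F ?f t"
    using partial_lfp_unfold[OF F, of V \<eta> t] \<open>t \<notin> V\<close> by simp
  have "partial_lfp F (insert t V) (\<eta>(t := ?f t)) \<le> ?f"
    by (rule partial_lfp_lowerbound) (auto simp: partial_lfp_unfold[OF F, of V])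
  then have "F (partial_lfp F (insert t V) (\<eta>(t := ?f t))) t \<subseteq> ?f t"
    using monoD[OF F] f by (metis le_funD)
  moreover have "?f t \<subseteq> S"
    using f S by simp
  ultimately show "\<Inter> {P. P \<subseteq> S \<and> F (partial_lfp F (insert t V) (\<eta>(t := P))) t \<subseteq> P} \<subseteq> ?f t"
    by blast
qed


section \<open>Expressibility in recHML\<close>

text \<open>Closure properties can thus be proved for operators on environments, with no explicit
  formulae; \<open>W\<close> bounds the free variables, so empty \<open>W\<close> means a closed
  formula.\<close>

definition expressible ::
    "'a set \<Rightarrow> 's set \<Rightarrow> ('s, 'a action) trans \<Rightarrow> nat set \<Rightarrow> ((nat \<Rightarrow> 's set) \<Rightarrow> 's set) \<Rightarrow> bool"
  where "expressible Act S R W F \<longleftrightarrow>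
    (\<exists>\<phi>. acts \<phi> \<subseteq> Act \<and> fv \<phi> \<subseteq> W \<and> (\<forall>\<rho>. sem S R \<phi> \<rho> = F \<rho>))"

lemma expressible_formI:
  "acts \<phi> \<subseteq> Act \<Longrightarrow> fv \<phi> \<subseteq> W \<Longrightarrow> (\<And>\<rho>. sem S R \<phi> \<rho> = F \<rho>) \<Longrightarrow> expressible Act S R W F"
  unfolding expressible_def by blast

lemma expressible_Int:
  assumes "expressible Act S R W F" and "expressible Act S R W G"
  shows "expressible Act S R W (\<lambda>\<rho>. F \<rho> \<inter> G \<rho>)"
proof -
  obtain \<phi> \<psi> where "acts \<phi> \<subseteq> Act" "fv \<phi> \<subseteq> W" "\<And>\<rho>. sem S R \<phi> \<rho> = F \<rho>"
    and "acts \<psi> \<subseteq> Act" "fv \<psi> \<subseteq> W" "\<And>\<rho>. sem S R \<psi> \<rho> = G \<rho>"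
    using assms by (auto simp: expressible_def)
  then show ?thesis
    unfolding expressible_def by (intro exI[of _ "And \<phi> \<psi>"]) auto
qed

text \<open>The intersection with \<open>S\<close> makes the empty conjunction the meaning of
  \<open>TT\<close> instead of the whole type.\<close>

lemma expressible_Inter:
  assumes "finite I" and "\<And>i. i \<in> I \<Longrightarrow> expressible Act S R W (F i)"
  shows "expressible Act S R W (\<lambda>\<rho>. S \<inter> (\<Inter>i\<in>I. F i \<rho>))"
  using assms
proof (induction I rule: finite_induct)
  case empty
  then show ?case
    by (intro expressible_formI[of TT]) auto
next
  case (insert i I)
  then have "expressible Act S R W (\<lambda>\<rho>. F i \<rho> \<inter> (S \<inter> (\<Inter>i\<in>I. F i \<rho>)))"
    by (intro expressible_Int insert.IH) simp_all
  then show ?case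
    by (simp add: Int_left_commute)
qed

lemma expressible_Box:
  assumes "expressible Act S R W F" and "\<alpha> \<in> Act_tau Act"
  shows "expressible Act S R W
    (\<lambda>\<rho>. {s \<in> S. converges R s \<and> (\<forall>s'. (s, s') \<in> weak R \<alpha> \<longrightarrow> s' \<in> F \<rho>)})"
proof -
  obtain \<phi> where "acts \<phi> \<subseteq> Act" "fv \<phi> \<subseteq> W" "\<And>\<rho>. sem S R \<phi> \<rho> = F \<rho>"
    using assms(1) by (auto simp: expressible_def)
  then show ?thesis
    using assms(2) unfolding expressible_def
    by (intro exI[of _ "Box \<alpha> \<phi>"]) (auto simp: Act_tau_def)
qed

lemma expressible_Acc:
  assumes "finite A" and "A \<subseteq> Act"
  shows "expressible Act S R W (\<lambda>\<rho>. {s \<in> S. converges R s \<and>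
    (\<forall>s'. (s, s') \<in> weak R Tau \<longrightarrow> (\<exists>a\<in>A. \<exists>s''. (s', s'') \<in> weak R (Ext a)))})"
proof -
  obtain B where "fset B = A"
    using assms(1) by (metis fset_cases mem_Collect_eq)
  then show ?thesis
    using assms(2) unfolding expressible_def
    by (intro exI[of _ "Acc B"]) (auto simp: Bex_def simp del: weak.simps)
qed

lemma expressible_FMin:
  assumes "expressible Act S R (insert X W) F"
  shows "expressible Act S R W (\<lambda>\<rho>. \<Inter> {P. P \<subseteq> S \<and> F (\<rho>(X := P)) \<subseteq> P})"
proof -
  obtain \<phi> where "acts \<phi> \<subseteq> Act" "fv \<phi> \<subseteq> insert X W" "\<And>\<rho>. sem S R \<phi> \<rho> = F \<rho>"
    using assms by (auto simp: expressible_def)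
  then show ?thesis
    unfolding expressible_def by (intro exI[of _ "FMin X \<phi>"]) auto
qed

text \<open>The formula is \<open>TT\<close> for a successful test, and otherwise a conjunction of
  one \<open>Box\<close> per transition, with an \<open>Acc\<close> added if \<open>t\<close> is
  stable. It is finite because labels and targets together are finitely many.\<close>

lemma expressible_must_rhs:
  assumes Q: "Q \<subseteq> T \<times> Act_test Act \<times> T"
    and fin: "finite {(l, u). (t, l, u) \<in> Q}"
    and G: "\<And>l u. (t, l, u) \<in> Q \<Longrightarrow> expressible Act S R W (\<lambda>\<rho>. G \<rho> u)"
  shows "expressible Act S R W (\<lambda>\<rho>. must_rhs S R Q (G \<rho>) t)"
proof (cases "success_test Q t")
  case True
  then show ?thesis
    by (intro expressible_formI[of TT]) (auto simp: must_rhs_def)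
next
  case False
  define I where "I = {(\<alpha>, u). (t, Lab \<alpha>, u) \<in> Q}"
  define box where "box = (\<lambda>(\<alpha>, u) \<rho>. {s \<in> S. converges R s \<and>
    (\<forall>s'. (s, s') \<in> weak R \<alpha> \<longrightarrow> s' \<in> G \<rho> u)})"
  define acc where "acc = {s \<in> S. converges R s \<and>
    (\<forall>s'. (s, s') \<in> weak R Tau \<longrightarrow> (\<exists>a\<in>initials Q t. \<exists>s''. (s', s'') \<in> weak R (Ext a)))}"
  have I: "I = (\<lambda>(\<alpha>, u). (Lab \<alpha>, u)) -` {(l, u). (t, l, u) \<in> Q}"
    by (auto simp: I_def)
  have finI: "finite I"
    unfolding I by (rule finite_vimageI[OF fin]) (auto simp: inj_on_def)
  have Act: "\<alpha> \<in> Act_tau Act" if "(t, Lab \<alpha>, u) \<in> Q" for \<alpha> u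
    using that Q by (auto simp: Act_test_def)
  have "expressible Act S R W (box i)" if "i \<in> I" for i
    using that expressible_Box[OF G Act] by (auto simp: I_def box_def)
  with finI have boxes: "expressible Act S R W (\<lambda>\<rho>. S \<inter> (\<Inter>i\<in>I. box i \<rho>))"
    by (rule expressible_Inter)
  show ?thesis
  proof (cases "stable_test Q t")
    case True
    \<comment> \<open>This gives the finiteness that \<open>Acc\<close> demands; the unspecified
      value of the \<open>case\<close> at \<open>Tau\<close> does no harm to an inclusion.\<close>
    have "initials Q t \<subseteq> (\<lambda>(\<alpha>, u). case \<alpha> of Ext a \<Rightarrow> a) ` I"
      by (force simp: initials_def I_def)
    then have "expressible Act S R W (\<lambda>\<rho>. acc)"
      unfolding acc_def using Act finI
      by (intro expressible_Acc)
        (auto simp: initials_def Act_tau_def elim: finite_subset intro: finite_imageI)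
    then have "expressible Act S R W (\<lambda>\<rho>. acc \<inter> (S \<inter> (\<Inter>i\<in>I. box i \<rho>)))"
      using boxes by (rule expressible_Int)
    moreover have "acc \<inter> (S \<inter> (\<Inter>i\<in>I. box i \<rho>)) = must_rhs S R Q (G \<rho>) t" for \<rho>
      using False True unfolding must_rhs_def acc_def box_def I_def by (auto simp del: weak.simps)
    ultimately show ?thesis
      by simp
  next
    case unstable: False
    \<comment> \<open>Without \<open>Acc\<close>, the convergence conjunct has to come from a box,
      and the tau-transition of \<open>t\<close> provides one.\<close>
    then have "I \<noteq> {}"
      by (auto simp: stable_test_def I_def)
    then have "S \<inter> (\<Inter>i\<in>I. box i \<rho>) = must_rhs S R Q (G \<rho>) t" for \<rho>
      using False unstable unfolding must_rhs_def box_def I_def by (auto simp del: weak.simps)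
    with boxes show ?thesis
      by simp
  qed
qed

text \<open>Induction on the number of unknowns in \<open>N\<close> not yet frozen. A frozen unknown
  is a variable; any other one is frozen in addition, its right-hand side is expressed by the
  hypothesis, and \<open>FMin\<close> binds the new variable.\<close>

lemma expressible_partial_lfp:
  assumes F: "mono F" and S: "\<And>f t. F f t \<subseteq> S"
    and "finite N" and inj: "inj_on idx N"
    and rhs: "\<And>t G W. t \<in> N \<Longrightarrow> (\<And>u. u \<in> N \<Longrightarrow> expressible Act S R W (\<lambda>\<rho>. G \<rho> u))
      \<Longrightarrow> expressible Act S R W (\<lambda>\<rho>. F (G \<rho>) t)"
    and "V \<subseteq> N" and "t \<in> N"
  shows "expressible Act S R (idx ` V) (\<lambda>\<rho>. partial_lfp F V (\<rho> \<circ> idx) t)"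
  using \<open>V \<subseteq> N\<close> \<open>t \<in> N\<close>
proof (induction "card (N - V)" arbitrary: V t rule: less_induct)
  case less
  show ?case
  proof (cases "t \<in> V")
    case True
    then show ?thesis
      by (intro expressible_formI[of "Var (idx t)"]) (auto simp: partial_lfp_unfold[OF F])
  next
    case False
    let ?G = "\<lambda>\<rho>. partial_lfp F (insert t V) (\<rho> \<circ> idx)"
    have "card (N - insert t V) < card (N - V)"
      using less.prems False \<open>finite N\<close> by (intro psubset_card_mono) auto
    then have "expressible Act S R (insert (idx t) (idx ` V)) (\<lambda>\<rho>. F (?G \<rho>) t)"
      using less.hyps[of "insert t V"] less.prems by (intro rhs) auto
    then have "expressible Act S R (idx ` V)
        (\<lambda>\<rho>. \<Inter> {P. P \<subseteq> S \<and> F (?G (\<rho>(idx t := P))) t \<subseteq> P})"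
      by (rule expressible_FMin)
    \<comment> \<open>Injectivity of \<open>idx\<close> on \<open>N\<close> ensures that updating
      the variable of \<open>t\<close> changes no other frozen unknown.\<close>
    moreover have "?G (\<rho>(idx t := P)) = partial_lfp F (insert t V) ((\<rho> \<circ> idx)(t := P))" for \<rho> P
      using inj less.prems by (intro partial_lfp_cong) (auto simp: inj_on_def)
    ultimately show ?thesis
      by (simp add: partial_lfp_bekic[OF F False S])
  qed
qed

section \<open>Assembling the representing formula of a finitary test\<close>

theorem theorem4p18:
  fixes Act :: "'a set"
    and S :: "'s set" and R :: "('s, 'a action) trans"
    and T :: "'t set" and Q :: "('t, 'a test_action) trans"
    and t :: 't
  assumes "lts S (Act_tau Act) R"
    and "finite_branching S R"
    and "lts T (Act_test Act) Q"
    and "t \<in> T"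
    and "finitary Q t"
  shows "must_representable Act S R Q t"
proof -
  have R: "R \<subseteq> S \<times> Act_tau Act \<times> S" and Q: "Q \<subseteq> T \<times> Act_test Act \<times> T"
    using assms by (auto simp: lts_def)
  define N where "N = accessible Q t"
  define F where "F = must_rhs S R Q"
  \<comment> \<open>\<open>M\<close> solves the equations of all test states; only its components in
    \<open>N\<close>, a set closed under transitions, need formulae.\<close>
  define M where "M = partial_lfp F {} (\<lambda>_. {})"
  have finN: "finite N" and finQ: "finite {(u, l, v). (u, l, v) \<in> Q \<and> u \<in> N}"
    using assms(5) by (auto simp: finitary_def N_def)
  have "t \<in> N"
    by (simp add: N_def accessible_def)
  have closed: "v \<in> N" if "u \<in> N" "(u, l, v) \<in> Q" for u l v
    using that unfolding N_def accessible_def Succ_def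
    by (auto intro: rtrancl_into_rtrancl)
  have F: "mono F"
    unfolding F_def by (rule monoI, rule le_funI, rule must_rhs_mono)
  have F_S: "F f u \<subseteq> S" for f u
    by (auto simp: F_def must_rhs_def)
  obtain idx :: "'t \<Rightarrow> nat" where "inj_on idx N"
    using finite_imp_inj_to_nat_seg[OF finN] by blast
  \<comment> \<open>With nothing frozen, the resulting formula is closed and its value does not
    depend on the environment.\<close>
  have "expressible Act S R (idx ` {}) (\<lambda>\<rho>. partial_lfp F {} (\<rho> \<circ> idx) t)"
  proof (rule expressible_partial_lfp[OF F _ finN \<open>inj_on idx N\<close> _ empty_subsetI \<open>t \<in> N\<close>])
    show "F f u \<subseteq> S" for f u
      by (rule F_S)
    show "expressible Act S R W (\<lambda>\<rho>. F (G \<rho>) u)"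
      if "u \<in> N" and G: "\<And>v. v \<in> N \<Longrightarrow> expressible Act S R W (\<lambda>\<rho>. G \<rho> v)" for u G W
    proof -
      have "finite {(l, v). (u, l, v) \<in> Q}"
        by (rule finite_subset[OF _ finite_imageI[OF finQ, of snd]]) (use \<open>u \<in> N\<close> in force)
      then show ?thesis
        unfolding F_def using expressible_must_rhs[OF Q] G closed \<open>u \<in> N\<close> by blast
    qed
  qed
  moreover have "partial_lfp F {} (\<rho> \<circ> idx) = M" for \<rho>
    unfolding M_def by (rule partial_lfp_cong) simp
  ultimately obtain \<phi> where \<phi>: "\<phi> \<in> recHML Act" "sem0 S R \<phi> = M t"
    by (auto simp: expressible_def recHML_def sem0_def)
  have M_unfold: "M u = must_rhs S R Q M u" for u
    using partial_lfp_unfold[OF F, of "{}"] by (simp add: M_def F_def)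
  \<comment> \<open>Leastness of \<open>M\<close> gives one direction; the converse below needs only
    that \<open>M\<close> is a fixed point.\<close>
  have "M \<le> (\<lambda>u. {p \<in> S. passes R Q (p, u)})"
    unfolding M_def
  proof (rule partial_lfp_lowerbound)
    fix u
    show "(if u \<in> {} then {} else F (\<lambda>u. {p \<in> S. passes R Q (p, u)}) u)
      \<subseteq> {p \<in> S. passes R Q (p, u)}"
      using must_rhs_passes_subset[OF R refl] F_S[THEN subsetD] unfolding F_def by fastforce
  qed
  then have "p \<in> M t \<longleftrightarrow> must_satisfy R Q p t" if "p \<in> S" for p
    using passes_subset_must_rhs_fixpoint[OF R M_unfold _ that] that
    by (auto simp: must_satisfy_iff_passes le_fun_def)
  then show ?thesis
    using \<phi> unfolding must_representable_def by blast
qed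

end
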